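(* Thompson's group $T$ satisfies $\operatorname{utww}(T)=2$.
   Context: Twin-width of matrices. A matrix (of any cardinality, with totally ordered rows and columns) is binary if its entries are $0$ or $1$; it is a bijection matrix if each row and each column contains exactly one $1$. A row/column identification replaces two consecutive rows (or two consecutive columns) by a single row (column) each of whose entries is the maximum of the two corresponding entries. For a finite $m\times n$ binary matrix $M$, consider sequences $M=M_{m+n},M_{m+n-1},\dots,M_2$, each term obtained from the previous one by one row/column identification, ending in a $1\times1$ matrix. The width of the sequence is the maximum number of $1$'s in a single row or column of any matrix of the sequence. The strict twin-width $\operatorname{stww}(M)$ is the minimum width over all such sequences. For an infinite matrix, $\operatorname{stww}$ is the supremum of $\operatorname{stww}$ over its finite submatrices (with the induced orders). For a permutation $\sigma$ of a totally ordered set $(X,<)$, $M_\sigma$ is the $X\times X$ matrix with $M_\sigma(x,y)=1$ iff $\sigma(x)=y$ (and $0$ otherwise), rows and columns ordered by $<$. Uniform twin-width. For a group $G$ and $g\in G$ let $R_g\colon G\to G$, $R_g(x)=xg$. The uniform twin-width is $\operatorname{utww}(G)=\min_{<}\sup_{g\in G}\operatorname{stww}(M_{R_g})\in\mathbb N\cup\{\infty\}$, the minimum over all total orders $<$ on $G$. Thompson's group $T$ is, in its standard realization, the group of orientation-preserving dyadic piecewise-linear homeomorphisms of the circle $S^1=\mathbb R/\mathbb Z$: those mapping dyadic rationals to dyadic rationals, differentiable except at finitely many dyadic rational points, with all slopes powers of $2$. *)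

theory Defs
  imports "HOL-Analysis.Analysis" "HOL-Algebra.Group" "Jordan_Normal_Form.Matrix"
begin

section \<open>Strict twin-width of finite binary matrices\<close>

definition identify_rows :: "nat \<Rightarrow> nat mat \<Rightarrow> nat mat" where
  "identify_rows k A = mat (dim_row A - 1) (dim_col A)
     (\<lambda>(i, j). if i < k then A $$ (i, j)
               else if i = k then max (A $$ (k, j)) (A $$ (Suc k, j))
               else A $$ (Suc i, j))"

definition identify_cols :: "nat \<Rightarrow> nat mat \<Rightarrow> nat mat" where
  "identify_cols k A = mat (dim_row A) (dim_col A - 1)
     (\<lambda>(i, j). if j < k then A $$ (i, j)
               else if j = k then max (A $$ (i, k)) (A $$ (i, Suc k))
               else A $$ (i, Suc j))"

definition identification :: "nat mat \<Rightarrow> nat mat \<Rightarrow> bool" where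
  "identification A B \<longleftrightarrow>
     (\<exists>k. Suc k < dim_row A \<and> B = identify_rows k A) \<or>
     (\<exists>k. Suc k < dim_col A \<and> B = identify_cols k A)"

text \<open>The sequence is indexed downwards from \<open>m + n\<close> to \<open>2\<close>, so that \<open>S i\<close> is a matrix
  whose numbers of rows and of columns add up to \<open>i\<close>.\<close>

definition identification_sequence :: "nat mat \<Rightarrow> (nat \<Rightarrow> nat mat) \<Rightarrow> bool" where
  "identification_sequence M S \<longleftrightarrow>
     S (dim_row M + dim_col M) = M \<and>
     (\<forall>i\<in>{2..<dim_row M + dim_col M}. identification (S (Suc i)) (S i)) \<and>
     S 2 \<in> carrier_mat 1 1"

definition row_ones :: "nat mat \<Rightarrow> nat \<Rightarrow> nat" where
  "row_ones A i = card {j. j < dim_col A \<and> A $$ (i, j) = 1}"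

definition col_ones :: "nat mat \<Rightarrow> nat \<Rightarrow> nat" where
  "col_ones A j = card {i. i < dim_row A \<and> A $$ (i, j) = 1}"

definition max_ones :: "nat mat \<Rightarrow> nat" where
  "max_ones A = Max (row_ones A ` {..<dim_row A} \<union> col_ones A ` {..<dim_col A})"

definition sequence_width :: "nat mat \<Rightarrow> (nat \<Rightarrow> nat mat) \<Rightarrow> nat" where
  "sequence_width M S = (MAX i\<in>{2..dim_row M + dim_col M}. max_ones (S i))"

definition stww_mat :: "nat mat \<Rightarrow> nat" where
  "stww_mat M = (LEAST w. \<exists>S. identification_sequence M S \<and> sequence_width M S = w)"


section \<open>Matrices indexed by arbitrary totally ordered sets\<close>

text \<open>A total order on a set is a reflexive relation \<open>r\<close> with \<open>linear_order_on X r\<close>.\<close>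

definition increasing_list :: "('a \<times> 'a) set \<Rightarrow> 'a set \<Rightarrow> 'a list" where
  "increasing_list r A =
     (THE xs. set xs = A \<and> sorted_wrt (\<lambda>x y. (x, y) \<in> r \<and> x \<noteq> y) xs)"

definition finite_submatrix ::
  "('a \<times> 'a) set \<Rightarrow> ('b \<times> 'b) set \<Rightarrow> ('a \<Rightarrow> 'b \<Rightarrow> nat) \<Rightarrow> 'a set \<Rightarrow> 'b set \<Rightarrow> nat mat" where
  "finite_submatrix r s M A B =
     mat (card A) (card B) (\<lambda>(i, j). M (increasing_list r A ! i) (increasing_list s B ! j))"

text \<open>Submatrices with no rows or no columns are left out: they admit no sequence of
  identifications ending in a \<open>1 \<times> 1\<close> matrix.\<close>

definition stww ::
  "'a set \<Rightarrow> ('a \<times> 'a) set \<Rightarrow> 'b set \<Rightarrow> ('b \<times> 'b) set \<Rightarrow> ('a \<Rightarrow> 'b \<Rightarrow> nat) \<Rightarrow> enat" where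
  "stww X r Y s M =
     (if finite X \<and> finite Y then enat (stww_mat (finite_submatrix r s M X Y))
      else (SUP (A, B)\<in>{(A, B). A \<subseteq> X \<and> finite A \<and> A \<noteq> {} \<and> B \<subseteq> Y \<and> finite B \<and> B \<noteq> {}}.
              enat (stww_mat (finite_submatrix r s M A B))))"

definition map_matrix :: "('a \<Rightarrow> 'a) \<Rightarrow> 'a \<Rightarrow> 'a \<Rightarrow> nat" where
  "map_matrix \<sigma> x y = (if \<sigma> x = y then 1 else 0)"


section \<open>Uniform twin-width of a group\<close>

definition right_translation :: "('a, 'b) monoid_scheme \<Rightarrow> 'a \<Rightarrow> 'a \<Rightarrow> 'a" where
  "right_translation G g x = x \<otimes>\<^bsub>G\<^esub> g"

text \<open>The infimum is a minimum, because \<open>enat\<close> is well-ordered and every set carries a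
  total order.\<close>

definition utww :: "('a, 'b) monoid_scheme \<Rightarrow> enat" where
  "utww G = (INF r\<in>{r. linear_order_on (carrier G) r}.
               SUP g\<in>carrier G.
                 stww (carrier G) r (carrier G) r (map_matrix (right_translation G g)))"


section \<open>The circle\<close>

quotient_type circle = real / "\<lambda>x y :: real. x - y \<in> \<int>"
  morphisms rep_circle circle_of
proof (rule equivpI)
  show "reflp (\<lambda>x y :: real. x - y \<in> \<int>)"
    by (simp add: reflp_def)
  show "symp (\<lambda>x y :: real. x - y \<in> \<int>)"
    by (metis (no_types, lifting) Ints_minus minus_diff_eq sympI)
  show "transp (\<lambda>x y :: real. x - y \<in> \<int>)"
    by (rule transpI) (metis Ints_add add_diff_eq diff_add_cancel)
qed

instantiation circle :: topological_space
begin

definition open_circle :: "circle set \<Rightarrow> bool" where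
  "open_circle U \<longleftrightarrow> open (circle_of -` U)"

instance
  by standard (auto simp: open_circle_def vimage_Union)

end


section \<open>Thompson's group T\<close>

definition dyadic_rationals :: "real set" where
  "dyadic_rationals = {of_int a / 2 ^ n | (a :: int) (n :: nat). True}"

definition dyadic_points :: "circle set" where
  "dyadic_points = circle_of ` dyadic_rationals"

text \<open>A lift determines the map, and two continuous lifts of the same map differ by an integer
  constant. A homeomorphism of the circle preserves orientation iff its continuous lifts are
  increasing; its local behaviour (linearity, slopes) is that of its lifts.\<close>

definition is_lift :: "(real \<Rightarrow> real) \<Rightarrow> (circle \<Rightarrow> circle) \<Rightarrow> bool" where
  "is_lift F f \<longleftrightarrow> continuous_on UNIV F \<and> (\<forall>x. f (circle_of x) = circle_of (F x))"

text \<open>Piecewise linear, differentiable away from finitely many dyadic points of the circle, and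
  with slopes powers of \<open>2\<close>: on every interval that contains no breakpoint, \<open>F\<close> is affine with
  such a slope.\<close>

definition dyadic_piecewise_linear :: "(real \<Rightarrow> real) \<Rightarrow> bool" where
  "dyadic_piecewise_linear F \<longleftrightarrow>
     (\<exists>B \<subseteq> dyadic_points. finite B \<and>
        (\<forall>a b. circle_of ` {a<..<b} \<inter> B = {} \<longrightarrow>
           (\<exists>(k :: int) c. \<forall>x\<in>{a<..<b}. F x = 2 powi k * x + c)))"

definition thompson_T_maps :: "(circle \<Rightarrow> circle) set" where
  "thompson_T_maps =
     {f. (\<exists>g. homeomorphism UNIV UNIV f g) \<and>
         f ` dyadic_points \<subseteq> dyadic_points \<and>
         (\<exists>F. is_lift F f \<and> strict_mono F \<and> dyadic_piecewise_linear F)}"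

definition thompson_T :: "(circle \<Rightarrow> circle) monoid" where
  "thompson_T = \<lparr>carrier = thompson_T_maps, mult = (\<circ>), one = id\<rparr>"

end

theory Submission
  imports Defs
begin

text \<open>The bound \<open>utww T \<ge> 2\<close> has nothing to do with \<open>T\<close>. Under any order, translation by the neutral
  element has the identity matrices among its finite submatrices, and the first identification in
  an identity matrix of size at least \<open>2\<close> puts two ones into one line (\<open>two_le_utww\<close>).

  For the upper bound, recall that a group with an order invariant under right translations has
  matrices of translations whose ones form an increasing chain; these are contracted from one
  end. Since \<open>T\<close> has torsion, it has no invariant order, but its action on the circle yields an
  invariant cyclic order, and this suffices. Fix a point \<open>p\<close> of the line. Every \<open>x \<in> T\<close> has
  exactly one lift \<open>X\<close> of \<open>x\<inverse>\<close> with \<open>0 \<le> X p < 1\<close> (\<open>normal_lift\<close>). Order \<open>T\<close> by comparing these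
  lifts lexicographically along a well-order of the reals that begins with \<open>p\<close>. If \<open>G\<close> is a lift
  of \<open>g\<inverse>\<close>, then the normalised lift of \<open>(x \<circ> g)\<inverse>\<close> is \<open>G \<circ> X\<close> minus one of two consecutive
  integers, the smaller of them for \<open>x\<close> in an initial segment \<open>L\<close> of \<open>T\<close>. So right translation by
  \<open>g\<close> is increasing on \<open>L\<close> and on its complement, and it puts the image of \<open>L\<close> above the image of
  the complement (\<open>cyclic_normal_lift\<close>): up to a cyclic rotation, it is increasing.

  It remains to contract the matrix of such a map with width \<open>2\<close> (\<open>contractible_cyclic\<close>). Rows and
  columns of zeros are absorbed by a neighbour. When none is left, the matrix is a permutation
  matrix of a cyclic rotation, and some two consecutive rows have their ones in two consecutive
  columns (\<open>cyclic_adjacent_pair\<close>). Identifying these rows and then these columns makes the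
  \<open>2 \<times> 2\<close> block a single one. Only the matrix in between has a line with two ones, and the result
  is again a submatrix of the given matrix.\<close>

section \<open>Contractions of bounded width\<close>

text \<open>Unlike \<^const>\<open>identification_sequence\<close>, this form of the existence of a sequence of width at
  most \<open>w\<close> is extended by a single identification without any reindexing.\<close>

inductive contractible :: "nat \<Rightarrow> nat mat \<Rightarrow> bool" for w where
  one: "A \<in> carrier_mat 1 1 \<Longrightarrow> max_ones A \<le> w \<Longrightarrow> contractible w A"
| step: "max_ones A \<le> w \<Longrightarrow> identification A B \<Longrightarrow> contractible w B \<Longrightarrow> contractible w A"

lemma identification_dim:
  assumes "identification A B"
  shows "dim_row A + dim_col A = Suc (dim_row B + dim_col B)"
  using assms by (auto simp: identification_def identify_rows_def identify_cols_def)

lemma contractible_dim: "contractible w A \<Longrightarrow> 2 \<le> dim_row A + dim_col A"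
  by (induction rule: contractible.induct) (auto dest: identification_dim)

lemma contractible_sequence:
  assumes "contractible w A"
  shows "\<exists>S. identification_sequence A S \<and> (\<forall>i\<in>{2..dim_row A + dim_col A}. max_ones (S i) \<le> w)"
  using assms
proof (induction rule: contractible.induct)
  case (one A)
  then show ?case
    by (intro exI[of _ "\<lambda>_. A"]) (auto simp: identification_sequence_def)
next
  case (step A B)
  then obtain S where S: "identification_sequence B S"
    "\<forall>i\<in>{2..dim_row B + dim_col B}. max_ones (S i) \<le> w" by blast
  note d = identification_dim[OF step.hyps(2)] and d2 = contractible_dim[OF step.hyps(3)]
  let ?S = "S(dim_row A + dim_col A := A)"
  have "identification_sequence A ?S"
    using S(1) d d2 step.hyps(2)
    by (auto simp: identification_sequence_def less_Suc_eq)
  moreover have "\<forall>i\<in>{2..dim_row A + dim_col A}. max_ones (?S i) \<le> w"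
    using S(2) d step.hyps(1) by (auto simp: le_Suc_eq)
  ultimately show ?case by blast
qed

lemma stww_mat_le:
  assumes "contractible w A"
  shows "stww_mat A \<le> w"
proof -
  obtain S where S: "identification_sequence A S"
    "\<forall>i\<in>{2..dim_row A + dim_col A}. max_ones (S i) \<le> w"
    using contractible_sequence[OF assms] by blast
  have "stww_mat A \<le> sequence_width A S"
    unfolding stww_mat_def using S(1) by (intro Least_le) blast
  also have "\<dots> \<le> w"
    unfolding sequence_width_def using S(2) contractible_dim[OF assms]
    by (subst Max_le_iff) auto
  finally show ?thesis .
qed

lemma max_ones_le_iff:
  assumes "0 < dim_row A \<or> 0 < dim_col A"
  shows "max_ones A \<le> w \<longleftrightarrow>
    (\<forall>i<dim_row A. row_ones A i \<le> w) \<and> (\<forall>j<dim_col A. col_ones A j \<le> w)"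
  unfolding max_ones_def using assms by (subst Max_le_iff) auto

text \<open>The merged row is the union of two rows, while a column can only lose ones. This bounds
  the matrix halfway through the contraction of a \<open>2 \<times> 2\<close> block.\<close>

lemma max_ones_identify_rows:
  assumes A: "max_ones A \<le> w" and k: "Suc k < dim_row A"
  shows "max_ones (identify_rows k A) \<le> 2 * w"
proof -
  let ?B = "identify_rows k A"
  have rows: "\<And>i. i < dim_row A \<Longrightarrow> row_ones A i \<le> w"
    and cols: "\<And>j. j < dim_col A \<Longrightarrow> col_ones A j \<le> w"
    using A k by (auto simp: max_ones_le_iff)
  have "row_ones ?B i \<le> 2 * w" if i: "i < dim_row ?B" for i
  proof (cases "i = k")
    case True
    have "row_ones ?B i \<le>
      card ({j. j < dim_col A \<and> A $$ (k, j) = 1} \<union> {j. j < dim_col A \<and> A $$ (Suc k, j) = 1})"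
      unfolding row_ones_def using k True
      by (intro card_mono) (auto simp: identify_rows_def max_def split: if_splits)
    also have "\<dots> \<le> row_ones A k + row_ones A (Suc k)"
      unfolding row_ones_def by (rule card_Un_le)
    also have "\<dots> \<le> 2 * w" using rows[of k] rows[of "Suc k"] k by simp
    finally show ?thesis .
  next
    case False
    then have "row_ones ?B i = row_ones A (if i < k then i else Suc i)"
      using i unfolding row_ones_def
      by (intro arg_cong[of _ _ card]) (auto simp: identify_rows_def)
    also have "\<dots> \<le> w" using i k by (intro rows) (auto simp: identify_rows_def)
    finally show ?thesis by simp
  qed
  moreover have "col_ones ?B j \<le> 2 * w" if j: "j < dim_col ?B" for j
  proof -
    have j': "j < dim_col A" using j by (simp add: identify_rows_def)
    have "{i. i < dim_row ?B \<and> ?B $$ (i, j) = 1} \<subseteq>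
      (\<lambda>i. if i \<le> k then i else i - 1) ` {i. i < dim_row A \<and> A $$ (i, j) = 1}"
    proof
      fix i assume "i \<in> {i. i < dim_row ?B \<and> ?B $$ (i, j) = 1}"
      then have i: "i < dim_row A - 1" "?B $$ (i, j) = 1"
        by (auto simp: identify_rows_def)
      consider "i < k" | "i = k" "A $$ (k, j) = 1" | "i = k" "A $$ (Suc k, j) = 1" | "i > k"
        using i j' by (cases i k rule: linorder_cases)
          (auto simp: identify_rows_def max_def split: if_splits)
      then show "i \<in> (\<lambda>i. if i \<le> k then i else i - 1) ` {i. i < dim_row A \<and> A $$ (i, j) = 1}"
      proof cases
        case 1 then show ?thesis using i j' by (intro image_eqI[of _ _ i]) (auto simp: identify_rows_def)
      next
        case 2 then show ?thesis using k by (intro image_eqI[of _ _ i]) auto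
      next
        case 3 then show ?thesis using k by (intro image_eqI[of _ _ "Suc i"]) auto
      next
        case 4 then show ?thesis using i j' by (intro image_eqI[of _ _ "Suc i"]) (auto simp: identify_rows_def)
      qed
    qed
    then have "col_ones ?B j \<le> col_ones A j"
      unfolding col_ones_def by (rule surj_card_le[rotated]) simp
    then show ?thesis using cols[OF j'] by simp
  qed
  ultimately show ?thesis
    using k by (subst max_ones_le_iff) (auto simp: identify_rows_def)
qed

section \<open>Matrices of partial injections\<close>

text \<open>A submatrix of the matrix of a map is given by the lists of its rows and columns, so that deleting
  a line of the matrix means deleting an entry of a list.\<close>

definition point_matrix :: "('a \<Rightarrow> 'b) \<Rightarrow> 'a list \<Rightarrow> 'b list \<Rightarrow> nat mat" where
  "point_matrix \<sigma> xs ys =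
     mat (length xs) (length ys) (\<lambda>(i, j). of_bool (\<sigma> (xs ! i) = ys ! j))"

lemma dim_point_matrix [simp]:
  "dim_row (point_matrix \<sigma> xs ys) = length xs" "dim_col (point_matrix \<sigma> xs ys) = length ys"
  by (simp_all add: point_matrix_def)

lemma card_le_Suc_0I:
  assumes "\<And>i j. i \<in> S \<Longrightarrow> j \<in> S \<Longrightarrow> i = (j :: nat)"
  shows "card S \<le> 1"
proof (cases "finite S")
  case True
  then show ?thesis using card_le_Suc0_iff_eq[OF True] assms by auto
qed simp

lemma max_ones_point_matrix:
  assumes "xs \<noteq> []" "distinct xs" "distinct ys" "inj_on \<sigma> (set xs)"
  shows "max_ones (point_matrix \<sigma> xs ys) \<le> 1"
proof (subst max_ones_le_iff, goal_cases)
  case 2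
  have "row_ones (point_matrix \<sigma> xs ys) i \<le> 1" if "i < length xs" for i
    unfolding row_ones_def using that assms(3)
    by (intro card_le_Suc_0I) (auto simp: point_matrix_def nth_eq_iff_index_eq simp del: One_nat_def)
  moreover have "col_ones (point_matrix \<sigma> xs ys) j \<le> 1" if "j < length ys" for j
  proof -
    have "i = i'" if "i < length xs" "i' < length xs" "\<sigma> (xs ! i) = \<sigma> (xs ! i')" for i i'
      using that assms(2,4) by (metis inj_onD nth_eq_iff_index_eq nth_mem)
    then show ?thesis
      unfolding col_ones_def using that
      by (intro card_le_Suc_0I) (auto simp: point_matrix_def simp del: One_nat_def)
  qed
  ultimately show ?case by simp
qed (use assms in auto)

text \<open>A line of zeros contributes nothing to a maximum, so identifying it with a neighbour on
  either side deletes it.\<close>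

lemma drop_left_row:
  assumes "\<sigma> x \<notin> set ys"
  shows "identify_rows (length us) (point_matrix \<sigma> (us @ x # x' # vs) ys) =
    point_matrix \<sigma> (us @ x' # vs) ys"
  using assms by (intro eq_matI)
    (auto simp: identify_rows_def point_matrix_def nth_append nth_Cons' not_less max_def
      dest: nth_mem)

lemma drop_right_row:
  assumes "\<sigma> x' \<notin> set ys"
  shows "identify_rows (length us) (point_matrix \<sigma> (us @ x # x' # vs) ys) =
    point_matrix \<sigma> (us @ x # vs) ys"
  using assms by (intro eq_matI)
    (auto simp: identify_rows_def point_matrix_def nth_append nth_Cons' not_less max_def
      dest: nth_mem)

lemma drop_left_col:
  assumes "y \<notin> \<sigma> ` set xs"
  shows "identify_cols (length us) (point_matrix \<sigma> xs (us @ y # y' # vs)) =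
    point_matrix \<sigma> xs (us @ y' # vs)"
  using assms by (intro eq_matI)
    (auto simp: identify_cols_def point_matrix_def nth_append nth_Cons' not_less max_def
      dest: nth_mem)

lemma drop_right_col:
  assumes "y' \<notin> \<sigma> ` set xs"
  shows "identify_cols (length us) (point_matrix \<sigma> xs (us @ y # y' # vs)) =
    point_matrix \<sigma> xs (us @ y # vs)"
  using assms by (intro eq_matI)
    (auto simp: identify_cols_def point_matrix_def nth_append nth_Cons' not_less max_def
      dest: nth_mem)

lemma nth_insert_after:
  "i \<le> length us \<Longrightarrow> (us @ x # x' # vs) ! i = (us @ x # vs) ! i"
  "length us < i \<Longrightarrow> (us @ x # x' # vs) ! Suc i = (us @ x # vs) ! i"
  "(us @ x # x' # vs) ! Suc (length us) = x'"
  by (auto simp: nth_append nth_Cons' Suc_diff_le)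

text \<open>Injectivity makes all other entries of the two rows and of the two columns zero. Hence both
  kinds of permutation block, diagonal and antidiagonal, are contracted to a single one, as if one
  of the rows and one of the columns were deleted.\<close>

lemma merge_block:
  assumes xs: "distinct (us @ x # x' # vs)" and ys: "distinct (ps @ y # y' # qs)"
    and inj: "inj_on \<sigma> (set (us @ x # x' # vs))"
    and block: "{\<sigma> x, \<sigma> x'} = {y, y'}"
  shows "identify_cols (length ps) (identify_rows (length us)
      (point_matrix \<sigma> (us @ x # x' # vs) (ps @ y # y' # qs))) =
    point_matrix \<sigma> (us @ x # vs) (ps @ \<sigma> x # qs)"
proof -
  have other_rows: "\<sigma> z \<noteq> y" "\<sigma> z \<noteq> y'" "\<sigma> z \<noteq> \<sigma> x" if "z \<in> set us \<union> set vs" for z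
  proof -
    have "z \<noteq> x" "z \<noteq> x'" using that xs by auto
    then have "\<sigma> z \<noteq> \<sigma> x" "\<sigma> z \<noteq> \<sigma> x'" using that inj_onD[OF inj, of z] by auto
    then show "\<sigma> z \<noteq> y" "\<sigma> z \<noteq> y'" "\<sigma> z \<noteq> \<sigma> x" using block by auto
  qed
  have other_cols: "\<sigma> x \<noteq> z" "\<sigma> x' \<noteq> z" if "z \<in> set ps \<union> set qs" for z
    using that ys block by (auto simp: doubleton_eq_iff)
  let ?xs = "us @ x # x' # vs" and ?ys = "ps @ y # y' # qs"
  let ?zs = "us @ x # vs" and ?ws = "ps @ \<sigma> x # qs"
  let ?B = "identify_rows (length us) (point_matrix \<sigma> ?xs ?ys)"
  have B: "?B $$ (i, j) =
      of_bool (if i = length us then ?ys ! j \<in> {y, y'} else \<sigma> (?zs ! i) = ?ys ! j)"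
    if "i < length ?zs" "j < length ?ys" for i j
  proof (cases i "length us" rule: linorder_cases)
    case less
    then show ?thesis using that nth_insert_after(1)[of i us x x' vs]
      by (simp add: identify_rows_def point_matrix_def)
  next
    case equal
    have "max (of_bool P) (of_bool Q) = (of_bool (P \<or> Q) :: nat)" for P Q by simp
    then show ?thesis
      using equal that nth_insert_after(1)[of i us x x' vs] nth_insert_after(3)[of us x x' vs] block
      by (simp add: identify_rows_def point_matrix_def) (metis insert_iff singletonD)
  next
    case greater
    then show ?thesis using that nth_insert_after(2)[of us i x x' vs]
      by (simp add: identify_rows_def point_matrix_def)
  qed
  show ?thesis
  proof (rule eq_matI, goal_cases)
    case (1 i j)
    then have i: "i < length ?zs" and j: "j < length ?ws" by simp_all
    have C: "identify_cols (length ps) ?B $$ (i, j) =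
      (if j < length ps then ?B $$ (i, j)
       else if j = length ps then max (?B $$ (i, j)) (?B $$ (i, Suc j)) else ?B $$ (i, Suc j))"
      using i j by (simp add: identify_cols_def identify_rows_def)
    have z: "?zs ! i \<in> set us \<union> set vs" if "i \<noteq> length us"
      using that i by (auto simp: nth_append nth_Cons')
    have R: "point_matrix \<sigma> ?zs ?ws $$ (i, j) = of_bool (\<sigma> (?zs ! i) = ?ws ! j)"
      using i j by (simp add: point_matrix_def)
    show ?case
    proof (cases j "length ps" rule: linorder_cases)
      case less
      then have "?ys ! j = ps ! j" "?ws ! j = ps ! j" "ps ! j \<in> set ps" by (simp_all add: nth_append)
      then show ?thesis using less B[OF i, of j] other_cols[of "ps ! j"] ys unfolding C R by auto
    next
      case equal
      have "?ys ! j = y" "?ys ! Suc j = y'" "?ws ! j = \<sigma> x"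
        using equal nth_insert_after(3)[of ps y y' qs] by simp_all
      then show ?thesis
        using equal B[OF i, of j] B[OF i, of "Suc j"] other_rows[OF z] unfolding C R
        by (cases "i = length us") simp_all
    next
      case greater
      then obtain k where k: "j = Suc (length ps + k)" by (auto dest: less_imp_Suc_add)
      then have "?ys ! Suc j = qs ! k" "?ws ! j = qs ! k" "qs ! k \<in> set qs"
        using j by (simp_all add: nth_append)
      then show ?thesis
        using greater j B[OF i, of "Suc j"] other_cols[of "qs ! k"] ys unfolding C R by auto
    qed
  qed (auto simp: identify_rows_def identify_cols_def)
qed

section \<open>Cyclically monotone injections\<close>

lemma sorted_wrt_asymp_distinct:
  assumes "asymp lt" "sorted_wrt lt xs"
  shows "distinct xs"
  using assms(2) by (induction xs) (use assms(1) in \<open>auto dest: asympD\<close>)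

lemma sorted_wrt_asymp_unique:
  assumes "asymp lt" "sorted_wrt lt xs" "sorted_wrt lt ys" "set xs = set ys"
  shows "xs = ys"
  using assms(2-4)
proof (induction xs arbitrary: ys)
  case (Cons x xs)
  then obtain y ys' where ys: "ys = y # ys'" by (cases ys) auto
  have irr: "\<not> lt z z" for z using assms(1) by (auto dest: asympD)
  have "x = y"
  proof (rule ccontr)
    assume "x \<noteq> y"
    then have "x \<in> set ys'" "y \<in> set xs" using Cons.prems(3) ys by auto
    then have "lt x y" "lt y x" using Cons.prems(1,2) ys by auto
    then show False using assms(1) by (auto dest: asympD)
  qed
  moreover have "x \<notin> set xs" "y \<notin> set ys'" using Cons.prems(1,2) ys irr by auto
  ultimately have "set xs = set ys'" using Cons.prems(3) ys by auto
  then show ?case using Cons.IH[of ys'] Cons.prems(1,2) ys \<open>x = y\<close> by auto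
qed simp

text \<open>The map is increasing up to a cyclic rotation that exchanges the initial segment \<open>L\<close> with its
  complement. Only points of \<open>X\<close> that are mapped into \<open>Y\<close> are constrained, which makes the
  property hereditary under passing to submatrices.\<close>

definition cyclic_on ::
  "('a \<Rightarrow> 'a \<Rightarrow> bool) \<Rightarrow> ('b \<Rightarrow> 'b \<Rightarrow> bool) \<Rightarrow> 'a set \<Rightarrow> ('a \<Rightarrow> 'b) \<Rightarrow> 'a set \<Rightarrow> 'b set \<Rightarrow> bool" where
  "cyclic_on lt lt' L \<sigma> X Y \<longleftrightarrow>
     (\<forall>x\<in>X. \<forall>y\<in>X. lt x y \<and> \<sigma> x \<in> Y \<and> \<sigma> y \<in> Y \<longrightarrow>
        (y \<in> L \<longrightarrow> x \<in> L) \<and>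
        (if x \<in> L \<and> y \<notin> L then lt' (\<sigma> y) (\<sigma> x) else lt' (\<sigma> x) (\<sigma> y)))"

lemma cyclic_on_mono:
  "cyclic_on lt lt' L \<sigma> X Y \<Longrightarrow> X' \<subseteq> X \<Longrightarrow> Y' \<subseteq> Y \<Longrightarrow> cyclic_on lt lt' L \<sigma> X' Y'"
  unfolding cyclic_on_def by blast

text \<open>Let \<open>as\<close> and \<open>bs\<close> be the parts of \<open>xs\<close> inside and outside of \<open>L\<close>. Then \<open>xs\<close> is \<open>as @ bs\<close>, and \<open>ys\<close> is
  the sequence of images of \<open>bs @ as\<close>. Two neighbours in the same part remain neighbours; if
  neither part has two entries, then there are just two rows, with adjacent images in reversed
  order.\<close>

lemma cyclic_adjacent_pair:
  assumes lt: "asymp lt" and lt': "asymp lt'"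
    and xs: "sorted_wrt lt xs" and ys: "sorted_wrt lt' ys"
    and cyc: "cyclic_on lt lt' L \<sigma> (set xs) (set ys)"
    and onto: "set ys = \<sigma> ` set xs" and len: "2 \<le> length xs"
  obtains us x x' vs ps y y' qs where
    "xs = us @ x # x' # vs" "ys = ps @ y # y' # qs" "{\<sigma> x, \<sigma> x'} = {y, y'}"
proof -
  define as bs where "as = filter (\<lambda>x. x \<in> L) xs" and "bs = filter (\<lambda>x. x \<notin> L) xs"
  have cycD: "y \<in> L \<Longrightarrow> x \<in> L" "x \<in> L \<Longrightarrow> y \<notin> L \<Longrightarrow> lt' (\<sigma> y) (\<sigma> x)"
    "(x \<in> L \<longleftrightarrow> y \<in> L) \<Longrightarrow> lt' (\<sigma> x) (\<sigma> y)"
    if "x \<in> set xs" "y \<in> set xs" "lt x y" for x y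
    using cyc that onto unfolding cyclic_on_def by (auto split: if_splits)
  have total: "lt x y \<or> x = y \<or> lt y x" if "x \<in> set xs" "y \<in> set xs" for x y
    using that xs by (metis in_set_conv_nth linorder_neqE_nat sorted_wrt_iff_nth_less)
  have cross: "lt x y" if "x \<in> set as" "y \<in> set bs" for x y
    using that total[of x y] cycD(1)[of y x] by (auto simp: as_def bs_def)
  have as: "sorted_wrt lt as" and bs: "sorted_wrt lt bs"
    using xs by (auto simp: as_def bs_def sorted_wrt_filter)
  have "sorted_wrt lt (as @ bs)" using as bs cross by (auto simp: sorted_wrt_append)
  moreover have "set (as @ bs) = set xs" by (auto simp: as_def bs_def)
  ultimately have xs_eq: "xs = as @ bs" using sorted_wrt_asymp_unique[OF lt xs] by metis
  have "sorted_wrt lt' (map \<sigma> as)"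
    unfolding sorted_wrt_map by (rule sorted_wrt_mono_rel[OF _ as]) (auto simp: as_def intro!: cycD(3))
  moreover have "sorted_wrt lt' (map \<sigma> bs)"
    unfolding sorted_wrt_map by (rule sorted_wrt_mono_rel[OF _ bs]) (auto simp: bs_def intro!: cycD(3))
  moreover have "lt' (\<sigma> y) (\<sigma> x)" if "x \<in> set as" "y \<in> set bs" for x y
    using that cross[OF that] by (auto simp: as_def bs_def intro!: cycD(2))
  ultimately have "sorted_wrt lt' (map \<sigma> bs @ map \<sigma> as)" by (auto simp: sorted_wrt_append)
  moreover have "set (map \<sigma> bs @ map \<sigma> as) = set ys" using onto xs_eq by auto
  ultimately have ys_eq: "ys = map \<sigma> bs @ map \<sigma> as" using sorted_wrt_asymp_unique[OF lt' ys] by metis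
  consider (as) x x' as' where "as = x # x' # as'" | (bs) x x' bs' where "bs = x # x' # bs'"
    | (single) x x' where "as = [x]" "bs = [x']"
    using len xs_eq by (cases as rule: remdups_adj.cases; cases bs rule: remdups_adj.cases) auto
  then show ?thesis
  proof cases
    case as
    show ?thesis
      by (rule that[of "[]" x x' "as' @ bs" "map \<sigma> bs" "\<sigma> x" "\<sigma> x'" "map \<sigma> as'"])
        (simp_all add: xs_eq ys_eq as)
  next
    case bs
    show ?thesis
      by (rule that[of as x x' bs' "[]" "\<sigma> x" "\<sigma> x'" "map \<sigma> bs' @ map \<sigma> as"])
        (simp_all add: xs_eq ys_eq bs)
  next
    case single
    show ?thesis
      by (rule that[of "[]" x x' "[]" "[]" "\<sigma> x'" "\<sigma> x" "[]"])
        (auto simp: xs_eq ys_eq single)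
  qed
qed

lemma identification_rowsI:
  "xs = us @ x # x' # vs \<Longrightarrow> identification (point_matrix \<sigma> xs ys) (identify_rows (length us) (point_matrix \<sigma> xs ys))"
  unfolding identification_def by (intro disjI1 exI[of _ "length us"]) auto

lemma identification_colsI:
  "ys = us @ x # x' # vs \<Longrightarrow> identification (point_matrix \<sigma> xs ys) (identify_cols (length us) (point_matrix \<sigma> xs ys))"
  unfolding identification_def by (intro disjI2 exI[of _ "length us"]) auto

lemma list_split_neighbour:
  assumes "x \<in> set xs" "xs \<noteq> [x]"
  obtains us x' vs where "xs = us @ x # x' # vs" | us x' vs where "xs = us @ x' # x # vs"
proof -
  obtain us vs where xs: "xs = us @ x # vs" using assms(1) by (meson split_list)
  show ?thesis
  proof (cases vs)
    case Nil
    then show ?thesis using that(2) xs assms(2) by (cases us rule: rev_cases) auto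
  next
    case (Cons x' vs')
    then show ?thesis using that(1) xs by blast
  qed
qed

text \<open>A contraction step deletes lines, directly or by way of a \<open>2 \<times> 2\<close> block, so all
  hypotheses are inherited by the smaller matrix.\<close>

lemma contractible_cyclic:
  assumes lt: "asymp lt" and lt': "asymp lt'"
    and "sorted_wrt lt xs" "sorted_wrt lt' ys" "cyclic_on lt lt' L \<sigma> (set xs) (set ys)"
    and "inj_on \<sigma> (set xs)" "xs \<noteq> []" "ys \<noteq> []"
  shows "contractible 2 (point_matrix \<sigma> xs ys)"
  using assms(3-)
proof (induction "length xs + length ys" arbitrary: xs ys rule: less_induct)
  case less
  note distinct = sorted_wrt_asymp_distinct[OF lt less.prems(1)] sorted_wrt_asymp_distinct[OF lt' less.prems(2)]
  have width1: "max_ones (point_matrix \<sigma> xs ys) \<le> 1"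
    using max_ones_point_matrix less.prems distinct by blast
  then have width: "max_ones (point_matrix \<sigma> xs ys) \<le> 2" by simp
  have smaller: "contractible 2 (point_matrix \<sigma> xs' ys')"
    if "length xs' + length ys' < length xs + length ys" "set xs' \<subseteq> set xs" "set ys' \<subseteq> set ys"
      "sorted_wrt lt xs'" "sorted_wrt lt' ys'" "xs' \<noteq> []" "ys' \<noteq> []" for xs' ys'
    using that less.prems by (intro less.hyps) (auto intro: cyclic_on_mono inj_on_subset)
  \<comment> \<open>A matrix with a single row and several columns has a column of zeros, because the row has
    at most one one. Hence a zero line that is not the only line of its direction is missing
    only in the two extreme cases.\<close>
  consider (one) "length xs = 1" "length ys = 1"
    | (row) x where "x \<in> set xs" "xs \<noteq> [x]" "\<sigma> x \<notin> set ys"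
    | (col) y where "y \<in> set ys" "ys \<noteq> [y]" "y \<notin> \<sigma> ` set xs"
    | (full) "set ys = \<sigma> ` set xs" "2 \<le> length xs"
  proof -
    have card: "card (set ys) = length ys" "card (\<sigma> ` set xs) = length xs"
      using distinct less.prems(4) by (simp_all add: card_image distinct_card)
    show ?thesis
    proof (cases "length xs = 1")
      case True
      show ?thesis
      proof (cases "length ys = 1")
        case False
        then have "\<not> set ys \<subseteq> \<sigma> ` set xs"
          using card True less.prems(6) card_mono[of "\<sigma> ` set xs" "set ys"] by (cases ys) auto
        then obtain y where "y \<in> set ys" "y \<notin> \<sigma> ` set xs" by blast
        moreover have "ys \<noteq> [y]" using False by auto
        ultimately show ?thesis using col by blast
      qed (use one True in blast)
    next
      case False
      then have len: "2 \<le> length xs" using less.prems(5) by (cases xs rule: remdups_adj.cases) auto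
      show ?thesis
      proof (cases "\<sigma> ` set xs \<subseteq> set ys")
        case True
        then have "2 \<le> length ys" using card len card_mono[of "set ys" "\<sigma> ` set xs"] by simp
        then have "ys \<noteq> [y]" for y by auto
        then show ?thesis using col full True len by blast
      next
        case False
        then obtain x where "x \<in> set xs" "\<sigma> x \<notin> set ys" by blast
        moreover have "xs \<noteq> [x]" using len by auto
        ultimately show ?thesis using row by blast
      qed
    qed
  qed
  then show ?case
  proof cases
    case one
    then show ?thesis using width by (intro contractible.one) auto
  next
    case row
    from row(1,2) show ?thesis
    proof (cases rule: list_split_neighbour)
      case (1 us x' vs)
      have "contractible 2 (point_matrix \<sigma> (us @ x' # vs) ys)"
        using 1 less.prems by (intro smaller) (auto simp: sorted_wrt_append)
      then show ?thesis
        using contractible.step[OF width identification_rowsI[OF 1]]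
        unfolding 1 drop_left_row[of \<sigma>, OF row(3)] by blast
    next
      case (2 us x' vs)
      have "contractible 2 (point_matrix \<sigma> (us @ x' # vs) ys)"
        using 2 less.prems by (intro smaller) (auto simp: sorted_wrt_append)
      then show ?thesis
        using contractible.step[OF width identification_rowsI[OF 2]]
        unfolding 2 drop_right_row[of \<sigma>, OF row(3)] by blast
    qed
  next
    case col
    from col(1,2) show ?thesis
    proof (cases rule: list_split_neighbour)
      case (1 us x' vs)
      have "contractible 2 (point_matrix \<sigma> xs (us @ x' # vs))"
        using 1 less.prems by (intro smaller) (auto simp: sorted_wrt_append)
      then show ?thesis
        using contractible.step[OF width identification_colsI[OF 1]]
        unfolding 1 drop_left_col[OF col(3)] by blast
    next
      case (2 us x' vs)
      have "contractible 2 (point_matrix \<sigma> xs (us @ x' # vs))"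
        using 2 less.prems by (intro smaller) (auto simp: sorted_wrt_append)
      then show ?thesis
        using contractible.step[OF width identification_colsI[OF 2]]
        unfolding 2 drop_right_col[OF col(3)] by blast
    qed
  next
    case full
    obtain us x x' vs ps y y' qs where split: "xs = us @ x # x' # vs" "ys = ps @ y # y' # qs"
      and block: "{\<sigma> x, \<sigma> x'} = {y, y'}"
      by (rule cyclic_adjacent_pair[OF lt lt' less.prems(1-3) full])
    \<comment> \<open>The matrix between the two identifications is the only one with two ones in a line.\<close>
    let ?A = "point_matrix \<sigma> xs ys"
    let ?B = "identify_rows (length us) ?A"
    let ?C = "identify_cols (length ps) ?B"
    have "?C = point_matrix \<sigma> (us @ x # vs) (ps @ \<sigma> x # qs)"
      using distinct less.prems(4) block unfolding split by (rule merge_block)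
    moreover have "contractible 2 (point_matrix \<sigma> (us @ x # vs) (ps @ \<sigma> x # qs))"
      using less.prems(1,2) block unfolding split
      by (intro smaller) (auto simp: split sorted_wrt_append doubleton_eq_iff)
    ultimately have C: "contractible 2 ?C" by simp
    have "identification ?B ?C"
      unfolding identification_def
      by (intro disjI2 exI[of _ "length ps"]) (simp add: split identify_rows_def)
    moreover have "max_ones ?B \<le> 2"
      using max_ones_identify_rows[OF width1, of "length us"] split by simp
    ultimately have "contractible 2 ?B" using C contractible.step by blast
    then show ?thesis using contractible.step[OF width identification_rowsI[OF split(1)]] by blast
  qed
qed

section \<open>Bounds for matrices over ordered sets\<close>

abbreviation strict_part :: "('a \<times> 'a) set \<Rightarrow> 'a \<Rightarrow> 'a \<Rightarrow> bool" where
  "strict_part r \<equiv> (\<lambda>x y. (x, y) \<in> r \<and> x \<noteq> y)"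

lemma asymp_strict_part:
  assumes "linear_order_on X r"
  shows "asymp (strict_part r)"
  using assms by (auto simp: asymp_on_def linear_order_on_def partial_order_on_def dest: antisymD)

lemma sorted_wrt_list_exists:
  assumes "finite A" and trans: "\<And>x y z. lt x y \<Longrightarrow> lt y z \<Longrightarrow> lt x z"
    and total: "\<And>x y. x \<in> A \<Longrightarrow> y \<in> A \<Longrightarrow> x \<noteq> y \<Longrightarrow> lt x y \<or> lt y x"
  shows "\<exists>xs. set xs = A \<and> sorted_wrt lt xs"
  using assms(1) total
proof (induction A rule: finite_induct)
  case (insert a A)
  then obtain xs where xs: "set xs = A" "sorted_wrt lt xs" by auto
  let ?below = "filter (\<lambda>x. lt x a) xs" and ?above = "filter (lt a) xs"
  have "lt x a \<or> lt a x" if "x \<in> A" for x using insert.prems[of x a] insert.hyps(2) that by auto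
  then have "set (?below @ a # ?above) = insert a A" using xs(1) by auto
  moreover have "sorted_wrt lt (?below @ a # ?above)"
    using xs(2) by (auto simp: sorted_wrt_append sorted_wrt_filter intro: trans)
  ultimately show ?case by blast
qed simp

lemma increasing_list:
  assumes r: "linear_order_on X r" and A: "finite A" "A \<subseteq> X"
  shows "set (increasing_list r A) = A" "sorted_wrt (strict_part r) (increasing_list r A)"
proof -
  note asym = asymp_strict_part[OF r]
  have trans: "trans r" and total: "total_on X r"
    using r by (auto simp: linear_order_on_def partial_order_on_def preorder_on_def)
  have strict_trans: "strict_part r x z" if "strict_part r x y" "strict_part r y z" for x y z
    using that transD[OF trans, of x y z] asympD[OF asym, of x y] by auto
  have "\<exists>xs. set xs = A \<and> sorted_wrt (strict_part r) xs"
  proof (rule sorted_wrt_list_exists[OF A(1)])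
    show "strict_part r x z" if "strict_part r x y" "strict_part r y z" for x y z
      using that by (rule strict_trans)
    show "strict_part r x y \<or> strict_part r y x" if "x \<in> A" "y \<in> A" "x \<noteq> y" for x y
      using that total A(2) by (auto simp: total_on_def)
  qed
  then have "\<exists>!xs. set xs = A \<and> sorted_wrt (strict_part r) xs"
    by (rule ex_ex1I) (use sorted_wrt_asymp_unique[OF asym] in auto)
  from theI'[OF this] show "set (increasing_list r A) = A"
    "sorted_wrt (strict_part r) (increasing_list r A)"
    unfolding increasing_list_def by blast+
qed

lemma length_increasing_list:
  assumes "linear_order_on X r" "finite A" "A \<subseteq> X"
  shows "length (increasing_list r A) = card A"
  using distinct_card[OF sorted_wrt_asymp_distinct[OF asymp_strict_part[OF assms(1)]
        increasing_list(2)[OF assms]]]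
  unfolding increasing_list(1)[OF assms] by simp

lemma finite_submatrix_map_matrix:
  assumes "linear_order_on X r" "finite A" "A \<subseteq> X" "finite B" "B \<subseteq> X"
  shows "finite_submatrix r r (map_matrix \<sigma>) A B =
    point_matrix \<sigma> (increasing_list r A) (increasing_list r B)"
  using length_increasing_list[OF assms(1-3)] length_increasing_list[OF assms(1,4,5)]
  by (auto simp: finite_submatrix_def point_matrix_def map_matrix_def)

lemma contractible_finite_submatrix:
  assumes r: "linear_order_on X r" and A: "finite A" "A \<subseteq> X" "A \<noteq> {}"
    and B: "finite B" "B \<subseteq> X" "B \<noteq> {}"
    and inj: "inj_on \<sigma> X" and cyc: "cyclic_on (strict_part r) (strict_part r) L \<sigma> X X"
  shows "contractible 2 (finite_submatrix r r (map_matrix \<sigma>) A B)"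
proof -
  note lA = increasing_list[OF r A(1,2)] and lB = increasing_list[OF r B(1,2)]
  show ?thesis
    unfolding finite_submatrix_map_matrix[OF r A(1,2) B(1,2)]
  proof (rule contractible_cyclic[OF asymp_strict_part[OF r] asymp_strict_part[OF r]])
    show "cyclic_on (strict_part r) (strict_part r) L \<sigma>
        (set (increasing_list r A)) (set (increasing_list r B))"
      unfolding lA(1) lB(1) using cyc A(2) B(2) by (rule cyclic_on_mono)
    show "inj_on \<sigma> (set (increasing_list r A))"
      unfolding lA(1) using inj A(2) by (rule inj_on_subset)
  qed (use lA lB A(3) B(3) in auto)
qed

lemma stww_le_2:
  assumes r: "linear_order_on X r" and "X \<noteq> {}" and inj: "inj_on \<sigma> X"
    and cyc: "cyclic_on (strict_part r) (strict_part r) L \<sigma> X X"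
  shows "stww X r X r (map_matrix \<sigma>) \<le> 2"
proof -
  have "enat (stww_mat (finite_submatrix r r (map_matrix \<sigma>) A B)) \<le> 2"
    if "finite A" "A \<subseteq> X" "A \<noteq> {}" "finite B" "B \<subseteq> X" "B \<noteq> {}" for A B
    using stww_mat_le[OF contractible_finite_submatrix[OF r that inj cyc]]
    by (simp add: numeral_eq_enat)
  then show ?thesis
    unfolding stww_def using assms(2) by (auto intro!: SUP_least)
qed

text \<open>Two consecutive lines of an identity matrix have their ones in different places, so merging
  them gives a line with two ones.\<close>

lemma two_le_max_ones_identification:
  assumes r: "linear_order_on X r" and A: "finite A" "A \<subseteq> X"
    and id: "\<And>x. x \<in> A \<Longrightarrow> \<sigma> x = x"
    and step: "identification (finite_submatrix r r (map_matrix \<sigma>) A A) N"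
  shows "2 \<le> max_ones N"
proof -
  let ?M = "finite_submatrix r r (map_matrix \<sigma>) A A"
  let ?xs = "increasing_list r A"
  have distinct: "distinct ?xs"
    using asymp_strict_part[OF r] increasing_list(2)[OF r A] by (rule sorted_wrt_asymp_distinct)
  have entry: "?M $$ (i, j) = of_bool (i = j)" if "i < card A" "j < card A" for i j
  proof -
    have len: "length ?xs = card A" by (rule length_increasing_list[OF r A])
    then have "?xs ! i \<in> A" using that nth_mem[of i ?xs] increasing_list(1)[OF r A] by simp
    then have "\<sigma> (?xs ! i) = ?xs ! i" by (rule id)
    then show ?thesis
      using that len distinct unfolding finite_submatrix_map_matrix[OF r A A] point_matrix_def
      by (simp add: nth_eq_iff_index_eq)
  qed
  have dim: "dim_row ?M = card A" "dim_col ?M = card A" by (simp_all add: finite_submatrix_def)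
  consider (row) k where "Suc k < card A" "N = identify_rows k ?M"
    | (col) k where "Suc k < card A" "N = identify_cols k ?M"
    using step dim unfolding identification_def by auto
  then show ?thesis
  proof cases
    case row
    have "{k, Suc k} \<subseteq> {j. j < dim_col N \<and> N $$ (k, j) = 1}"
      using row dim entry by (auto simp: identify_rows_def)
    then have "2 \<le> row_ones N k"
      unfolding row_ones_def using card_mono[of "{j. j < dim_col N \<and> N $$ (k, j) = 1}" "{k, Suc k}"] by simp
    also have "\<dots> \<le> max_ones N"
      unfolding max_ones_def using row dim by (intro Max_ge) (auto simp: identify_rows_def)
    finally show ?thesis .
  next
    case col
    have "{k, Suc k} \<subseteq> {i. i < dim_row N \<and> N $$ (i, k) = 1}"
      using col dim entry by (auto simp: identify_cols_def)
    then have "2 \<le> col_ones N k"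
      unfolding col_ones_def using card_mono[of "{i. i < dim_row N \<and> N $$ (i, k) = 1}" "{k, Suc k}"] by simp
    also have "\<dots> \<le> max_ones N"
      unfolding max_ones_def using col dim by (intro Max_ge) (auto simp: identify_cols_def)
    finally show ?thesis .
  qed
qed

text \<open>Every contraction of an identity matrix of size at least \<open>2\<close> begins with an
  identification, which already has width \<open>2\<close>. The upper bound on the same matrix is needed to
  know that the minimum is attained by a sequence.\<close>

lemma two_le_stww_mat_identity:
  assumes r: "linear_order_on X r" and A: "finite A" "A \<subseteq> X" "2 \<le> card A"
    and id: "\<And>x. x \<in> A \<Longrightarrow> \<sigma> x = x"
  shows "2 \<le> stww_mat (finite_submatrix r r (map_matrix \<sigma>) A A)"
proof -
  let ?M = "finite_submatrix r r (map_matrix \<sigma>) A A"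
  let ?n = "dim_row ?M + dim_col ?M"
  have dim: "?n = 2 * card A" by (simp add: finite_submatrix_def)
  have "contractible 2 (point_matrix \<sigma> (increasing_list r A) (increasing_list r A))"
    by (rule contractible_cyclic[OF asymp_strict_part[OF r] asymp_strict_part[OF r], where L = UNIV])
      (use increasing_list[OF r A(1,2)] A(3) id in \<open>auto simp: cyclic_on_def inj_on_def\<close>)
  \<comment> \<open>Some sequence exists, hence the least width is the width of a sequence.\<close>
  then obtain S0 where S0: "identification_sequence ?M S0"
    using contractible_sequence unfolding finite_submatrix_map_matrix[OF r A(1,2) A(1,2)] by blast
  have "\<exists>S. identification_sequence ?M S \<and> sequence_width ?M S = stww_mat ?M"
    unfolding stww_mat_def
    by (rule LeastI[of "\<lambda>w. \<exists>S. identification_sequence ?M S \<and> sequence_width ?M S = w"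
          "sequence_width ?M S0"]) (use S0 in blast)
  then obtain S where S: "identification_sequence ?M S" "sequence_width ?M S = stww_mat ?M" by blast
  define m where "m = ?n - 1"
  have m: "?n = Suc m" "2 \<le> m" using dim A(3) by (auto simp: m_def)
  have "S (Suc m) = ?M" "\<forall>i\<in>{2..<Suc m}. identification (S (Suc i)) (S i)"
    using S(1) unfolding identification_sequence_def m(1) by blast+
  then have "identification ?M (S m)" using m(2) by (metis atLeastLessThan_iff lessI)
  then have "2 \<le> max_ones (S m)"
    using two_le_max_ones_identification[OF r A(1,2) id] by blast
  also have "\<dots> \<le> sequence_width ?M S"
    unfolding sequence_width_def m(1) using m(2) by (intro Max_ge) auto
  finally show ?thesis using S(2) by simp
qed

text \<open>A finite group admits only its whole matrix in \<^const>\<open>stww\<close>; an infinite one admits the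
  \<open>2 \<times> 2\<close> submatrix on the two given elements.\<close>

lemma two_le_utww:
  assumes one: "\<one>\<^bsub>G\<^esub> \<in> carrier G" "\<And>x. x \<in> carrier G \<Longrightarrow> x \<otimes>\<^bsub>G\<^esub> \<one>\<^bsub>G\<^esub> = x"
    and nontrivial: "a \<in> carrier G" "b \<in> carrier G" "a \<noteq> b"
  shows "2 \<le> utww G"
  unfolding utww_def
proof (rule INF_greatest, clarify)
  fix r assume r: "linear_order_on (carrier G) r"
  let ?X = "carrier G" and ?\<sigma> = "right_translation G \<one>\<^bsub>G\<^esub>"
  have id: "\<And>x. x \<in> ?X \<Longrightarrow> ?\<sigma> x = x" by (simp add: right_translation_def one)
  have "2 \<le> stww ?X r ?X r (map_matrix ?\<sigma>)"
  proof (cases "finite ?X")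
    case True
    then have "2 \<le> card ?X" using nontrivial card_mono[of ?X "{a, b}"] by simp
    then show ?thesis
      using two_le_stww_mat_identity[OF r True order_refl _ id] True
      by (simp add: stww_def numeral_eq_enat)
  next
    case False
    have "2 \<le> stww_mat (finite_submatrix r r (map_matrix ?\<sigma>) {a, b} {a, b})"
      using nontrivial id by (intro two_le_stww_mat_identity[OF r]) auto
    then have "2 \<le> enat (stww_mat (finite_submatrix r r (map_matrix ?\<sigma>) {a, b} {a, b}))"
      by (simp add: numeral_eq_enat)
    also have "\<dots> \<le> stww ?X r ?X r (map_matrix ?\<sigma>)"
      unfolding stww_def using False nontrivial
      by (simp, intro SUP_upper2[of "({a, b}, {a, b})"]) auto
    finally show ?thesis .
  qed
  also have "\<dots> \<le> (SUP g\<in>?X. stww ?X r ?X r (map_matrix (right_translation G g)))"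
    using one(1) by (rule SUP_upper)
  finally show "2 \<le> (SUP g\<in>?X. stww ?X r ?X r (map_matrix (right_translation G g)))" .
qed

section \<open>Lexicographic orders on spaces of functions\<close>

text \<open>The relation \<open>W\<close> is meant to be a well-order: distinct functions then have a first point of
  difference, and any two of them are comparable.\<close>

definition lex_less :: "('a \<times> 'a) set \<Rightarrow> ('a \<Rightarrow> 'b::linorder) \<Rightarrow> ('a \<Rightarrow> 'b) \<Rightarrow> bool" where
  "lex_less W f g \<longleftrightarrow> (\<exists>q. f q < g q \<and> (\<forall>q'. (q', q) \<in> W \<and> q' \<noteq> q \<longrightarrow> f q' = g q'))"

lemma lex_less_total:
  assumes W: "well_order_on UNIV W" and "f \<noteq> g"
  shows "lex_less W f g \<or> lex_less W g f"
proof -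
  have wf: "wf (W - Id)" using W by (simp add: well_order_on_def)
  obtain x where "x \<in> {q. f q \<noteq> g q}" using assms(2) by auto
  with wf obtain q where q: "f q \<noteq> g q" "\<And>q'. (q', q) \<in> W - Id \<Longrightarrow> f q' = g q'"
    by (rule wfE_min) blast
  then show ?thesis unfolding lex_less_def by (metis DiffI pair_in_Id_conv linorder_neqE)
qed

lemma lex_less_trans:
  assumes W: "well_order_on UNIV W" and fg: "lex_less W f g" and gh: "lex_less W g h"
  shows "lex_less W f h"
proof -
  have trans: "trans W" and total: "total W" and anti: "antisym W"
    using W by (auto simp: well_order_on_def linear_order_on_def partial_order_on_def preorder_on_def)
  obtain p where p: "f p < g p" "\<And>q'. (q', p) \<in> W \<Longrightarrow> q' \<noteq> p \<Longrightarrow> f q' = g q'"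
    using fg by (auto simp: lex_less_def)
  obtain q where q: "g q < h q" "\<And>q'. (q', q) \<in> W \<Longrightarrow> q' \<noteq> q \<Longrightarrow> g q' = h q'"
    using gh by (auto simp: lex_less_def)
  consider "p = q" | "(p, q) \<in> W" "p \<noteq> q" | "(q, p) \<in> W" "p \<noteq> q"
    using total by (auto simp: total_on_def)
  then show ?thesis
  proof cases
    case 1
    then show ?thesis unfolding lex_less_def using p q by (intro exI[of _ p]) auto
  next
    case 2
    have "f q' = h q'" if "(q', p) \<in> W" "q' \<noteq> p" for q'
      using that p(2) q(2) 2 transD[OF trans that(1) 2(1)] antisymD[OF anti] by metis
    then show ?thesis unfolding lex_less_def using p(1) q(2)[OF 2] by (intro exI[of _ p]) auto
  next
    case 3
    have "f q' = h q'" if "(q', q) \<in> W" "q' \<noteq> q" for q'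
      using that p(2) q(2) 3 transD[OF trans that(1) 3(1)] antisymD[OF anti] by metis
    then show ?thesis unfolding lex_less_def using q(1) p(2)[OF 3(1)] 3(2) by (intro exI[of _ q]) auto
  qed
qed

lemma lex_less_irrefl: "\<not> lex_less W f f"
  by (simp add: lex_less_def)

lemma lex_less_leD:
  assumes "\<And>q. (p, q) \<in> W" "lex_less W f g"
  shows "f p \<le> g p"
  using assms unfolding lex_less_def by (metis less_imp_le order_refl)

text \<open>The first point \<open>p\<close> decides before all others. It is the point at which the lifts below are
  normalised.\<close>

lemma lex_less_headI:
  assumes W: "well_order_on UNIV W" and p: "\<And>q. (p, q) \<in> W" and "f p < g p"
  shows "lex_less W f g"
proof -
  have "antisym W"
    using W by (auto simp: well_order_on_def linear_order_on_def partial_order_on_def)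
  then show ?thesis unfolding lex_less_def using p assms(3) by (metis antisymD)
qed

lemma lex_less_strict_mono:
  assumes "strict_mono h" "lex_less W f g"
  shows "lex_less W (\<lambda>q. h (f q)) (\<lambda>q. h (g q))"
  using assms unfolding lex_less_def by (metis strict_mono_less)

definition lex_order :: "('c \<Rightarrow> 'a \<Rightarrow> 'b::linorder) \<Rightarrow> ('a \<times> 'a) set \<Rightarrow> 'c set \<Rightarrow> ('c \<times> 'c) set" where
  "lex_order N W X = {(x, y). x \<in> X \<and> y \<in> X \<and> (x = y \<or> lex_less W (N x) (N y))}"

lemma linear_order_lex_order:
  assumes W: "well_order_on UNIV W" and N: "inj_on N X"
  shows "linear_order_on X (lex_order N W X)"
proof -
  have "trans (lex_order N W X)"
    by (rule transI) (auto simp: lex_order_def dest: lex_less_trans[OF W])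
  moreover have "antisym (lex_order N W X)"
    by (rule antisymI) (auto simp: lex_order_def lex_less_irrefl dest: lex_less_trans[OF W])
  moreover have "total_on X (lex_order N W X)"
    using lex_less_total[OF W] inj_onD[OF N] unfolding total_on_def lex_order_def by blast
  ultimately show ?thesis
    unfolding linear_order_on_def partial_order_on_def preorder_on_def
    by (auto simp: lex_order_def refl_on_def)
qed

lemma well_order_least:
  assumes W: "well_order_on UNIV W"
  obtains p where "\<And>q. (p, q) \<in> W"
proof -
  have wf: "wf (W - Id)" using W by (simp add: well_order_on_def)
  obtain p where p: "\<And>q. (q, p) \<notin> W - Id" using wf by (rule wfE_min[of _ undefined UNIV]) auto
  have "(p, q) \<in> W" for q
    using W p[of q] unfolding well_order_on_def linear_order_on_def partial_order_on_def
      preorder_on_def refl_on_def total_on_def by (cases "p = q") auto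
  then show ?thesis using that by blast
qed

section \<open>Lifts of inverses of circle maps\<close>

lemma circle_of_eq_iff: "circle_of s = circle_of t \<longleftrightarrow> s - t \<in> \<int>"
  by (simp add: circle.abs_eq_iff)

lemma circle_cases: obtains t where "z = circle_of t"
  by (metis Quotient_circle Quotient_abs_rep)

text \<open>Lifts of homeomorphisms of the circle that preserve orientation have these two properties.\<close>

definition equivariant :: "(real \<Rightarrow> real) \<Rightarrow> bool" where
  "equivariant X \<longleftrightarrow> strict_mono X \<and> (\<forall>t. X (t + 1) = X t + 1)"

lemma equivariant_nat:
  assumes "equivariant X"
  shows "X (t + real n) = X t + real n"
  using assms by (induction n) (auto simp: equivariant_def add.assoc[symmetric] add.commute[of 1])

lemma equivariant_int:
  assumes X: "equivariant X"
  shows "X (t + of_int n) = X t + of_int n"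
proof (cases "0 \<le> n")
  case True
  then show ?thesis using equivariant_nat[OF X, of t "nat n"] by simp
next
  case False
  then show ?thesis using equivariant_nat[OF X, of "t + of_int n" "nat (- n)"] by simp
qed

text \<open>On \<open>[p, p + 1)\<close> both functions take values in the same half-open interval of length \<open>1\<close>, where an
  integer difference can only be \<open>0\<close>.\<close>

lemma equivariant_Ints_eqI:
  assumes X: "equivariant X" and Y: "equivariant Y"
    and diff: "\<And>t. X t - Y t \<in> \<int>" and p: "X p = Y p"
  shows "X = Y"
proof
  fix t
  define n where "n = \<lfloor>t - p\<rfloor>"
  define s where "s = t - of_int n"
  have s: "p \<le> s" "s < p + 1" unfolding s_def n_def by linarith+
  have "X p \<le> X s" "X s < X p + 1" "Y p \<le> Y s" "Y s < Y p + 1"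
    using X Y s unfolding equivariant_def by (metis strict_mono_less strict_mono_less_eq)+
  then have "\<bar>X s - Y s\<bar> < 1" using p by linarith
  then have "X s = Y s" using diff[of s] Ints_nonzero_abs_less1 by force
  moreover have "t = s + of_int n" by (simp add: s_def)
  ultimately show "X t = Y t" using equivariant_int[OF X] equivariant_int[OF Y] by simp
qed

text \<open>The difference \<open>F (t + 1) - F t\<close> is a positive integer. Were it at least \<open>2\<close>, then \<open>F\<close> would
  take the value \<open>F t + 1\<close> strictly inside \<open>(t, t + 1)\<close>, and \<open>f\<close> would not be injective.\<close>

lemma lift_equivariant:
  assumes F: "is_lift F f" "strict_mono F" and "inj f"
  shows "equivariant F"
proof -
  have lift: "f (circle_of x) = circle_of (F x)" for x using F(1) by (simp add: is_lift_def)
  have "F (t + 1) = F t + 1" for t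
  proof -
    have "circle_of (F (t + 1)) = circle_of (F t)"
      unfolding lift[symmetric] using circle_of_eq_iff[of "t + 1" t] by simp
    then obtain n where n: "F (t + 1) - F t = of_int n" by (auto simp: circle_of_eq_iff elim: Ints_cases)
    have "F t < F (t + 1)" using F(2) by (simp add: strict_mono_less)
    then have "1 \<le> n" using n by linarith
    have "\<not> 2 \<le> n"
    proof
      assume "2 \<le> n"
      then have "F t \<le> F t + 1" "F t + 1 \<le> F (t + 1)" using n by linarith+
      then obtain s where s: "t \<le> s" "s \<le> t + 1" "F s = F t + 1"
        using IVT'[of F t "F t + 1" "t + 1"] continuous_on_subset[of UNIV F "{t..t + 1}"] F(1)
        unfolding is_lift_def by auto
      have "circle_of (F s) = circle_of (F t)" using s by (simp add: circle_of_eq_iff)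
      then have "s - t \<in> \<int>"
        unfolding lift[symmetric] using assms(3) by (simp add: inj_eq circle_of_eq_iff)
      then obtain m where m: "s - t = of_int m" by (auto elim: Ints_cases)
      have "s \<noteq> t" "s \<noteq> t + 1" using s n \<open>2 \<le> n\<close> by auto
      then have "0 < real_of_int m" "real_of_int m < 1" using s(1,2) m by linarith+
      then show False by simp
    qed
    then show ?thesis using n \<open>1 \<le> n\<close> by simp
  qed
  then show ?thesis using F(2) by (simp add: equivariant_def)
qed

text \<open>The last condition says that \<open>X\<close> is a lift of the inverse of \<open>f\<close>. Inverses are used because
  right translation \<open>x \<mapsto> x \<circ> g\<close> is composition with the lift of \<open>g\<inverse>\<close> from the left on lifts of
  inverses, and so acts on their values; the formulation avoids the inverse in the circle.\<close>

definition inverse_lift :: "(real \<Rightarrow> real) \<Rightarrow> (circle \<Rightarrow> circle) \<Rightarrow> bool" where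
  "inverse_lift X f \<longleftrightarrow> equivariant X \<and> surj X \<and> (\<forall>t. f (circle_of (X t)) = circle_of t)"

lemma inverse_lift_exists:
  assumes F: "is_lift F f" "strict_mono F" and f: "bij f"
  shows "inverse_lift (inv_into UNIV F) f"
proof -
  have lift: "f (circle_of x) = circle_of (F x)" for x using F(1) by (simp add: is_lift_def)
  have eq: "equivariant F" using lift_equivariant[OF F] f by (simp add: bij_is_inj)
  have inj: "inj F" using F(2) by (rule strict_mono_imp_inj_on)
  have surj: "surj F"
  proof (rule surjI[of _ "inv_into UNIV F"])
    fix y
    obtain z where "f z = circle_of y" using f by (metis bij_pointE)
    then obtain t where "circle_of y = circle_of (F t)" using lift circle_cases by metis
    then obtain n where "y - F t = of_int n" by (auto simp: circle_of_eq_iff elim: Ints_cases)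
    then have "y = F (t + of_int n)" using equivariant_int[OF eq] by simp
    then show "F (inv_into UNIV F y) = y" using f_inv_into_f by (metis rangeI)
  qed
  have Finv: "F (inv_into UNIV F y) = y" for y using surj by (simp add: surj_f_inv_f)
  have "strict_mono (inv_into UNIV F)"
    by (rule strict_monoI) (metis F(2) Finv strict_mono_less)
  moreover have "inv_into UNIV F (t + 1) = inv_into UNIV F t + 1" for t
    using eq Finv inj by (metis equivariant_def inv_f_f)
  moreover have "surj (inv_into UNIV F)" using inj by (rule inj_imp_surj_inv)
  ultimately show ?thesis by (simp add: inverse_lift_def equivariant_def lift Finv)
qed

lemma equivariant_shift: "equivariant X \<Longrightarrow> equivariant (\<lambda>t. X t - c)"
  by (auto simp: equivariant_def strict_mono_def)

lemma inverse_lift_shift: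
  assumes X: "inverse_lift X f"
  shows "inverse_lift (\<lambda>t. X t - of_int n) f"
proof -
  have "surj (\<lambda>t. X t - of_int n)"
  proof (rule surjI)
    fix y show "X (inv_into UNIV X (y + of_int n)) - of_int n = y"
      using X by (simp add: inverse_lift_def surj_f_inv_f)
  qed
  moreover have "circle_of (X t - of_int n) = circle_of (X t)" for t
    by (simp add: circle_of_eq_iff)
  ultimately show ?thesis using X by (simp add: inverse_lift_def equivariant_shift)
qed

lemma inverse_lift_comp:
  assumes "inverse_lift X f" "inverse_lift G g"
  shows "inverse_lift (\<lambda>t. G (X t)) (f \<circ> g)"
  using assms comp_surj[of X G] by (auto simp: inverse_lift_def equivariant_def strict_mono_def comp_def)

text \<open>Here surjectivity of \<open>X\<close> enters: its values represent all points of the circle.\<close>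

lemma inverse_lift_inj:
  assumes f: "inverse_lift X f" and g: "inverse_lift X g"
  shows "f = g"
proof
  fix z
  obtain s where s: "z = circle_of s" by (rule circle_cases)
  obtain t where "s = X t" using f by (metis inverse_lift_def surjD)
  then show "f z = g z" using f g s by (simp add: inverse_lift_def)
qed

definition normal_lift :: "real \<Rightarrow> (circle \<Rightarrow> circle) \<Rightarrow> real \<Rightarrow> real" where
  "normal_lift p f = (THE X. inverse_lift X f \<and> 0 \<le> X p \<and> X p < 1)"

lemma normal_lift_eqI:
  assumes f: "inj f" and X: "inverse_lift X f" and p: "0 \<le> X p" "X p < 1"
  shows "normal_lift p f = X"
  unfolding normal_lift_def
proof (rule the_equality)
  fix Y assume Y: "inverse_lift Y f \<and> 0 \<le> Y p \<and> Y p < 1"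
  have diff: "Y t - X t \<in> \<int>" for t
  proof -
    have "f (circle_of (Y t)) = f (circle_of (X t))" using X Y by (simp add: inverse_lift_def)
    then show ?thesis using f by (simp add: inj_eq circle_of_eq_iff)
  qed
  moreover have "Y p = X p"
    using diff[of p] Y p Ints_nonzero_abs_less1[of "Y p - X p"] by (auto simp: abs_less_iff)
  ultimately show "Y = X" using X Y equivariant_Ints_eqI by (metis inverse_lift_def)
qed (use X p in blast)

lemma normal_lift:
  assumes f: "inj f" and X: "inverse_lift X f"
  shows "inverse_lift (normal_lift p f) f" "0 \<le> normal_lift p f p" "normal_lift p f p < 1"
proof -
  let ?Y = "\<lambda>t. X t - of_int \<lfloor>X p\<rfloor>"
  have Y: "inverse_lift ?Y f" using X by (rule inverse_lift_shift)
  have p: "0 \<le> ?Y p" "?Y p < 1" by linarith+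
  have "normal_lift p f = ?Y" using normal_lift_eqI[OF f Y p] .
  then show "inverse_lift (normal_lift p f) f" "0 \<le> normal_lift p f p" "normal_lift p f p < 1"
    using Y p by simp_all
qed

text \<open>This is the invariance of the cyclic order. With \<open>n = \<lfloor>G 0\<rfloor>\<close>, monotonicity gives
  \<open>n \<le> G (X p) < n + 2\<close>, so normalising \<open>G \<circ> X\<close> subtracts \<open>n\<close> or \<open>n + 1\<close>, and \<open>L\<close> consists of the
  elements for which it is \<open>n\<close>. Equal shifts preserve the lexicographic order. If \<open>x \<in> L\<close> and
  \<open>y \<notin> L\<close>, then \<open>Y p < 1 \<le> X p + 1\<close> yields \<open>G (Y p) - (n + 1) < G (X p) - n\<close>, so \<open>y \<circ> g\<close> comes
  before \<open>x \<circ> g\<close>.\<close>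

lemma cyclic_normal_lift:
  assumes W: "well_order_on UNIV W" and p: "\<And>q. (p, q) \<in> W"
    and T: "\<And>f. f \<in> T \<Longrightarrow> inj f" "\<And>f. f \<in> T \<Longrightarrow> \<exists>X. inverse_lift X f" and g: "g \<in> T"
  shows "\<exists>L. cyclic_on (strict_part (lex_order (normal_lift p) W T))
    (strict_part (lex_order (normal_lift p) W T)) L (\<lambda>x. x \<circ> g) T T"
proof -
  let ?N = "normal_lift p"
  obtain G where G: "inverse_lift G g" using T(2)[OF g] by blast
  then have mono: "strict_mono G" and shift: "G (t + 1) = G t + 1" for t
    by (auto simp: inverse_lift_def equivariant_def)
  define n where "n = \<lfloor>G 0\<rfloor>"
  have n: "of_int n \<le> G 0" "G 0 < of_int n + 1" unfolding n_def by linarith+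
  define L where "L = {x. G (?N x p) < of_int n + 1}"
  define k where "k x = (if x \<in> L then n else n + 1)" for x
  have N: "inverse_lift (?N x) x" "0 \<le> ?N x p" "?N x p < 1" if x: "x \<in> T" for x
  proof -
    obtain X where X: "inverse_lift X x" using T(2)[OF x] by blast
    show "inverse_lift (?N x) x" "0 \<le> ?N x p" "?N x p < 1"
      using normal_lift[OF T(1)[OF x] X] by simp_all
  qed
  have translate: "?N (x \<circ> g) = (\<lambda>t. G (?N x t) - of_int (k x))" if x: "x \<in> T" "x \<circ> g \<in> T" for x
  proof (rule normal_lift_eqI)
    show "inj (x \<circ> g)" using T(1) x(2) .
    show "inverse_lift (\<lambda>t. G (?N x t) - of_int (k x)) (x \<circ> g)"
      by (rule inverse_lift_shift[OF inverse_lift_comp[OF N(1)[OF x(1)] G]])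
    have "G 0 \<le> G (?N x p)" "G (?N x p) < G (0 + 1)"
      using N(2,3)[OF x(1)] by (simp_all add: strict_mono_less_eq[OF mono] strict_mono_less[OF mono])
    then show "0 \<le> G (?N x p) - of_int (k x)" "G (?N x p) - of_int (k x) < 1"
      using n unfolding shift by (auto simp: k_def L_def)
  qed
  have "cyclic_on (strict_part (lex_order ?N W T)) (strict_part (lex_order ?N W T)) L (\<lambda>x. x \<circ> g) T T"
    unfolding cyclic_on_def
  proof (intro ballI impI, elim conjE)
    fix x y assume x: "x \<in> T" "x \<circ> g \<in> T" and y: "y \<in> T" "y \<circ> g \<in> T"
      and "(x, y) \<in> lex_order ?N W T" "x \<noteq> y"
    then have less: "lex_less W (?N x) (?N y)" by (auto simp: lex_order_def)
    have le: "G (?N x p) \<le> G (?N y p)"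
      using lex_less_leD[OF p less] by (simp add: strict_mono_less_eq[OF mono])
    have LD: "y \<in> L \<longrightarrow> x \<in> L" using le by (auto simp: L_def)
    have swap: "lex_less W (?N (y \<circ> g)) (?N (x \<circ> g))" if "x \<in> L" "y \<notin> L"
    proof (rule lex_less_headI[OF W p])
      have "G (?N y p) < G (?N x p + 1)"
        using N(2)[OF x(1)] N(3)[OF y(1)] by (simp add: strict_mono_less[OF mono])
      then show "?N (y \<circ> g) p < ?N (x \<circ> g) p"
        using that unfolding translate[OF x] translate[OF y] shift by (simp add: k_def)
    qed
    have keep: "lex_less W (?N (x \<circ> g)) (?N (y \<circ> g))" if "k x = k y"
      unfolding translate[OF x] translate[OF y] that
      using less by (rule lex_less_strict_mono[rotated]) (use mono in \<open>auto simp: strict_mono_def\<close>)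
    have ne: "f \<noteq> h" if "lex_less W (?N f) (?N h)" for f h using that lex_less_irrefl by metis
    show "(y \<in> L \<longrightarrow> x \<in> L) \<and>
      (if x \<in> L \<and> y \<notin> L then strict_part (lex_order ?N W T) (y \<circ> g) (x \<circ> g)
       else strict_part (lex_order ?N W T) (x \<circ> g) (y \<circ> g))"
      using LD swap keep ne x y by (auto simp: lex_order_def k_def)
  qed
  then show ?thesis by blast
qed

section \<open>Thompson's group\<close>

lemma thompson_T_bij:
  assumes "f \<in> thompson_T_maps"
  shows "bij f"
proof -
  obtain g where "homeomorphism UNIV UNIV f g"
    using assms by (auto simp: thompson_T_maps_def)
  then show ?thesis
    by (intro bij_betw_byWitness[of _ g]) (auto simp: homeomorphism_def)
qed

lemma thompson_T_inverse_lift: "f \<in> thompson_T_maps \<Longrightarrow> \<exists>X. inverse_lift X f"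
  using inverse_lift_exists thompson_T_bij unfolding thompson_T_maps_def by blast

lemma dyadic_piecewise_linear_translation: "dyadic_piecewise_linear (\<lambda>x. x + c)"
  unfolding dyadic_piecewise_linear_def
  by (intro exI[of _ "{}"]) (auto intro!: exI[of _ 0] exI[of _ c])

lemma id_in_thompson_T: "id \<in> thompson_T_maps"
proof -
  have "homeomorphism UNIV UNIV (id :: circle \<Rightarrow> circle) id"
    by (auto simp: homeomorphism_def id_def)
  moreover have "is_lift id id" by (simp add: is_lift_def)
  moreover have "strict_mono (id :: real \<Rightarrow> real)" by (simp add: strict_mono_def)
  moreover have "dyadic_piecewise_linear id"
    using dyadic_piecewise_linear_translation[of 0] by (simp add: id_def)
  ultimately show ?thesis unfolding thompson_T_maps_def by auto
qed

text \<open>A second element of \<open>T\<close>, for the lower bound.\<close>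

lift_definition half_turn :: "circle \<Rightarrow> circle" is "\<lambda>x. x + 1 / 2"
  by simp

lemma half_turn_in_thompson_T: "half_turn \<in> thompson_T_maps"
proof -
  have involution: "half_turn (half_turn z) = z" for z
    by transfer simp
  have cont: "continuous_on UNIV half_turn"
  proof (subst continuous_on_open_vimage)
    show "\<forall>U. open U \<longrightarrow> open (half_turn -` U \<inter> UNIV)"
    proof (intro allI impI)
      fix U :: "circle set" assume "open U"
      then have "open (circle_of -` U)" by (simp add: open_circle_def)
      then have "open ((\<lambda>x. x + 1 / 2) -` (circle_of -` U))"
        by (rule open_vimage) (auto intro!: continuous_intros)
      moreover have "(\<lambda>x. x + 1 / 2) -` (circle_of -` U) = circle_of -` (half_turn -` U)"
        by (auto simp: half_turn.abs_eq)
      ultimately show "open (half_turn -` U \<inter> UNIV)" by (simp add: open_circle_def)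
    qed
  qed simp
  have "homeomorphism UNIV UNIV half_turn half_turn"
    using cont involution surjI[of half_turn half_turn] by (simp add: homeomorphism_def)
  moreover have "half_turn ` dyadic_points \<subseteq> dyadic_points"
  proof -
    have "of_int a / 2 ^ n + 1 / 2 \<in> dyadic_rationals" for a and n :: nat
    proof -
      have "of_int a / 2 ^ n + 1 / 2 = of_int (2 * a + 2 ^ n) / (2 ^ Suc n :: real)"
        by (simp add: field_simps)
      then show ?thesis unfolding dyadic_rationals_def by blast
    qed
    then have "x + 1 / 2 \<in> dyadic_rationals" if "x \<in> dyadic_rationals" for x
      using that unfolding dyadic_rationals_def by blast
    then show ?thesis by (auto simp: dyadic_points_def half_turn.abs_eq)
  qed
  moreover have "is_lift (\<lambda>x. x + 1 / 2) half_turn"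
    by (auto simp: is_lift_def half_turn.abs_eq intro!: continuous_intros)
  moreover have "strict_mono (\<lambda>x :: real. x + 1 / 2)" by (simp add: strict_mono_def)
  ultimately show ?thesis
    unfolding thompson_T_maps_def using dyadic_piecewise_linear_translation by blast
qed

lemma half_turn_neq_id: "half_turn \<noteq> id"
proof
  assume "half_turn = id"
  then have "circle_of (0 + 1 / 2) = circle_of 0" by (metis half_turn.abs_eq id_apply)
  then have "(1 / 2 :: real) \<in> \<int>" by (simp add: circle_of_eq_iff)
  then show False using Ints_nonzero_abs_less1[of "1 / 2 :: real"] by simp
qed

theorem theorem32:
  shows "utww thompson_T = 2"
proof (rule antisym)
  let ?T = thompson_T_maps
  have T: "carrier thompson_T = ?T" "\<one>\<^bsub>thompson_T\<^esub> = id"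
    "right_translation thompson_T g = (\<lambda>x. x \<circ> g)" for g
    by (auto simp: thompson_T_def right_translation_def)
  show "2 \<le> utww thompson_T"
    using id_in_thompson_T half_turn_in_thompson_T half_turn_neq_id
    by (intro two_le_utww[where a = half_turn and b = id]) (auto simp: thompson_T_def)
  obtain W :: "real rel" where W: "well_order_on UNIV W" using well_order_on by blast
  obtain p where p: "\<And>q. (p, q) \<in> W" using well_order_least[OF W] by blast
  let ?r = "lex_order (normal_lift p) W ?T"
  have inj: "inj f" if "f \<in> ?T" for f using thompson_T_bij[OF that] by (rule bij_is_inj)
  have "inj_on (normal_lift p) ?T"
  proof (rule inj_onI)
    fix f g assume f: "f \<in> ?T" and g: "g \<in> ?T" and eq: "normal_lift p f = normal_lift p g"
    have "inverse_lift (normal_lift p h) h" if "h \<in> ?T" for h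
      using normal_lift(1)[OF inj[OF that]] thompson_T_inverse_lift[OF that] by blast
    from this[OF f] this[OF g] show "f = g" unfolding eq by (rule inverse_lift_inj)
  qed
  then have r: "linear_order_on ?T ?r" using linear_order_lex_order[OF W] by blast
  have "stww ?T ?r ?T ?r (map_matrix (\<lambda>x. x \<circ> g)) \<le> 2" if g: "g \<in> ?T" for g
  proof -
    have "inj_on (\<lambda>x. x \<circ> g) ?T"
      using thompson_T_bij[OF g] by (auto simp: inj_on_def fun_eq_iff) (metis bij_pointE)
    moreover obtain L where "cyclic_on (strict_part ?r) (strict_part ?r) L (\<lambda>x. x \<circ> g) ?T ?T"
      using cyclic_normal_lift[OF W p inj thompson_T_inverse_lift g] by blast
    ultimately show ?thesis using stww_le_2[OF r] g by blast
  qed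
  then have "(SUP g\<in>?T. stww ?T ?r ?T ?r (map_matrix (\<lambda>x. x \<circ> g))) \<le> 2"
    by (rule SUP_least)
  then show "utww thompson_T \<le> 2"
    unfolding utww_def T using r by (intro INF_lower2[of ?r]) simp_all
qed

end
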